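(* Let $G$ be a simplicial graph, and let $\omega$ be its clique number. Then $$\lambda_1(G)\le \frac{-1}{4(\omega-1)}.$$
   Context: All graphs are finite, simple and undirected. A graph is claw-free if it has no induced $K_{1,3}$. A clique $K$ in $G$ is a simplicial clique if for every $u\in K$ the set of neighbors of $u$ outside $K$ is a clique. A graph is simplicial if it is claw-free and contains a simplicial clique. The univariate independence polynomial is $I(G)(x)=\sum_{S\subseteq V(G),\ S\text{ independent}}x^{|S|}$, and $\lambda_1(G)$ denotes its root closest to zero, i.e. its largest real root (for claw-free $G$ all roots are real and negative). The clique number $\omega$ is the number of vertices of a largest clique in $G$.
   Formalization: It is additionally assumed that every connected component of G is simplicial (automatic for connected G), with simplicial cliques nonempty; without this the claim fails, e.g. for an isolated vertex plus the complement of the circulant graph on Z/35 with connections ±1, ±7, ±11, ±16. *)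

theory Defs
  imports
    Complex_Main
    "HOL-Computational_Algebra.Polynomial"
    "Graph_Theory.Graph_Theory"
begin

text \<open>
  Finite simple undirected graphs are those satisfying the locale predicate
  \<^const>\<open>graph\<close>: finite, loop-free, symmetric digraphs without parallel arcs.
  Adjacency is \<^const>\<open>dominates\<close>.
\<close>

definition neighbors :: "('a, 'b) pre_digraph \<Rightarrow> 'a \<Rightarrow> 'a set" where
  "neighbors G u = {v. u \<rightarrow>\<^bsub>G\<^esub> v}"

definition clique :: "('a, 'b) pre_digraph \<Rightarrow> 'a set \<Rightarrow> bool" where
  "clique G K \<longleftrightarrow> K \<subseteq> verts G \<and> (\<forall>u\<in>K. \<forall>v\<in>K. u \<noteq> v \<longrightarrow> u \<rightarrow>\<^bsub>G\<^esub> v)"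

definition independent_set :: "('a, 'b) pre_digraph \<Rightarrow> 'a set \<Rightarrow> bool" where
  "independent_set G S \<longleftrightarrow> S \<subseteq> verts G \<and> (\<forall>u\<in>S. \<forall>v\<in>S. \<not> u \<rightarrow>\<^bsub>G\<^esub> v)"

definition clique_number :: "('a, 'b) pre_digraph \<Rightarrow> nat" where
  "clique_number G = Max (card ` {K. clique G K})"

definition claw_free :: "('a, 'b) pre_digraph \<Rightarrow> bool" where
  "claw_free G \<longleftrightarrow> \<not> (\<exists>H. induced_subgraph H G \<and> K\<^bsub>1,3\<^esub> H)"

text \<open>
  A simplicial clique is required to be nonempty: the empty set satisfies the remaining
  conditions in every graph, which would make every claw-free graph simplicial.
\<close>

definition simplicial_clique :: "('a, 'b) pre_digraph \<Rightarrow> 'a set \<Rightarrow> bool" where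
  "simplicial_clique G K \<longleftrightarrow>
     K \<noteq> {} \<and> clique G K \<and> (\<forall>u\<in>K. clique G (neighbors G u - K))"

definition simplicial_graph :: "('a, 'b) pre_digraph \<Rightarrow> bool" where
  "simplicial_graph G \<longleftrightarrow> claw_free G \<and> (\<exists>K. simplicial_clique G K)"

definition indep_poly :: "('a, 'b) pre_digraph \<Rightarrow> real poly" where
  "indep_poly G = (\<Sum>S | independent_set G S. monom 1 (card S))"

text \<open>
  The root closest to zero, i.e. the largest real root. For a claw-free graph all complex
  roots are real and negative, so the two descriptions agree, and for a nonempty vertex set
  the (finite) set of roots is nonempty, so the maximum is attained.
\<close>

definition lambda1 :: "('a, 'b) pre_digraph \<Rightarrow> real" where
  "lambda1 G = Max {x. poly (indep_poly G) x = 0}"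

text \<open>
  Connected components are the members of \<^const>\<open>pre_digraph.sccs\<close>: in a symmetric digraph
  the maximal strongly connected induced subgraphs are the components of the undirected graph.
\<close>

abbreviation components :: "('a, 'b) pre_digraph \<Rightarrow> ('a, 'b) pre_digraph set" where
  "components G \<equiv> pre_digraph.sccs G"

end

theory Submission
  imports Defs
begin

text \<open>
  Write \<open>f\<close> for the independence polynomial and \<open>N v\<close> for the neighbours of \<open>v\<close>. For a
  simplicial clique \<open>K\<close> of \<open>V\<close> we have
  \<open>f V x = f (V - K) x + x * (\<Sum>v\<in>K. f (V - K - N v) x)\<close>. In a claw-free graph \<open>N v - K\<close> is again
  a simplicial clique of \<open>V - K\<close>, and it has at most \<open>w = \<omega> - 1\<close> elements because \<open>v\<close> extends it.
  So \<open>f V / f (V - K)\<close> is a branching continued fraction in the manner of Heilmann and Lieb: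
  for \<open>x = - t\<close> with \<open>4 * t * w < 1\<close>, the bound \<open>1 / 2\<close> on the ratios for cliques of size
  at most \<open>w\<close> reproduces itself, since \<open>1 - t * w * 2 \<ge> 1 / 2\<close>. Hence \<open>f V (- t) > 0\<close>.

  A real root exists: if \<open>f V\<close> is positive on \<open>[- 1, 0]\<close>, then so is \<open>f U\<close> for every
  \<open>U \<subseteq> V\<close>, but for a single vertex \<open>f {v} (- 1) = 0\<close>.
\<close>

section \<open>Independence polynomials under vertex deletion\<close>

locale adjacency =
  fixes adj :: "'a \<Rightarrow> 'a \<Rightarrow> bool"
  assumes adj_sym: "adj u v \<Longrightarrow> adj v u"
    and adj_irrefl: "\<not> adj u u"
begin

lemma adj_commute: "adj u v \<longleftrightarrow> adj v u"
  using adj_sym by blast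

abbreviation nbhd :: "'a \<Rightarrow> 'a set" where
  "nbhd v \<equiv> {u. adj v u}"

definition stable :: "'a set \<Rightarrow> bool" where
  "stable S \<longleftrightarrow> (\<forall>u\<in>S. \<forall>v\<in>S. \<not> adj u v)"

definition complete :: "'a set \<Rightarrow> bool" where
  "complete K \<longleftrightarrow> (\<forall>u\<in>K. \<forall>v\<in>K. u \<noteq> v \<longrightarrow> adj u v)"

definition simplicial_in :: "'a set \<Rightarrow> 'a set \<Rightarrow> bool" where
  "simplicial_in V K \<longleftrightarrow> K \<subseteq> V \<and> complete K \<and> (\<forall>u\<in>K. complete (nbhd u \<inter> V - K))"

text \<open>Subgraphs are vertex sets of one fixed adjacency, so deletion is set difference; values
  suffice because all arguments concern signs at real points.\<close>

definition ipoly :: "'a set \<Rightarrow> real \<Rightarrow> real" where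
  "ipoly V x = (\<Sum>S | S \<subseteq> V \<and> stable S. x ^ card S)"

lemma ipoly_empty [simp]: "ipoly {} x = 1"
proof -
  have "{S. S \<subseteq> {} \<and> stable S} = {{}}"
    by (auto simp: stable_def)
  then show ?thesis by (simp add: ipoly_def)
qed

lemma ipoly_insert:
  assumes "finite V" "v \<notin> V"
  shows "ipoly (insert v V) x = ipoly V x + x * ipoly (V - nbhd v) x"
proof -
  let ?A = "{S. S \<subseteq> V \<and> stable S}" and ?B = "{S. S \<subseteq> V - nbhd v \<and> stable S}"
  have stable_insert: "stable (insert v S) \<longleftrightarrow> stable S \<and> S \<inter> nbhd v = {}" for S
    unfolding stable_def using adj_sym adj_irrefl by blast
  have split: "{S. S \<subseteq> insert v V \<and> stable S} = ?A \<union> insert v ` ?B"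
  proof (intro set_eqI iffI)
    fix S assume S: "S \<in> {S. S \<subseteq> insert v V \<and> stable S}"
    show "S \<in> ?A \<union> insert v ` ?B"
    proof (cases "v \<in> S")
      case True
      then have eq: "S = insert v (S - {v})" by auto
      with S stable_insert[of "S - {v}"] have "S - {v} \<in> ?B" by auto
      with eq show ?thesis by blast
    qed (use S in auto)
  qed (auto simp: stable_insert)
  have fin: "finite ?A" "finite ?B" using assms by auto
  have inj: "inj_on (insert v) ?B"
    using assms by (intro inj_on_inverseI[where g = "\<lambda>S. S - {v}"]) auto
  have "ipoly (insert v V) x = ipoly V x + (\<Sum>S\<in>insert v ` ?B. x ^ card S)"
    unfolding ipoly_def split using fin assms by (subst sum.union_disjoint) auto
  also have "(\<Sum>S\<in>insert v ` ?B. x ^ card S) = (\<Sum>S\<in>?B. x ^ card (insert v S))"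
    using inj by (simp add: sum.reindex)
  also have "\<dots> = (\<Sum>S\<in>?B. x * x ^ card S)"
  proof (rule sum.cong)
    fix S assume "S \<in> ?B"
    then have "finite S" "v \<notin> S" using assms by (auto intro: finite_subset)
    then show "x ^ card (insert v S) = x * x ^ card S" by simp
  qed simp
  finally show ?thesis by (simp add: ipoly_def sum_distrib_left)
qed

text \<open>A stable set meets a clique in at most one vertex. In the induction, deleting the
  neighbours of \<open>v\<close> removes the rest of the clique.\<close>

lemma ipoly_Un_complete:
  assumes "finite K" "complete K" "finite W" "W \<inter> K = {}"
  shows "ipoly (W \<union> K) x = ipoly W x + x * (\<Sum>v\<in>K. ipoly (W - nbhd v) x)"
  using assms
proof (induction K rule: finite_induct)
  case (insert v K)
  have *: "W \<union> K - nbhd v = W - nbhd v"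
    using insert.prems insert.hyps by (auto simp: complete_def)
  have "complete K" "W \<inter> K = {}"
    using insert.prems by (auto simp: complete_def)
  then show ?case
    using insert ipoly_insert[of "W \<union> K" v x] * by (simp add: algebra_simps)
qed simp

lemma ipoly_Diff_complete:
  assumes "finite V" "complete K" "K \<subseteq> V"
  shows "ipoly V x = ipoly (V - K) x + x * (\<Sum>v\<in>K. ipoly (V - K - nbhd v) x)"
  using ipoly_Un_complete[of K "V - K" x] assms
  by (simp add: finite_subset Un_absorb2 Diff_Int_distrib2)

section \<open>Signs on the real line and existence of a root\<close>

lemma ipoly_0:
  assumes "finite V"
  shows "ipoly V 0 = 1"
  using assms by (induction V rule: finite_induct) (simp_all add: ipoly_insert)

lemma ipoly_pos_of_nonneg:
  assumes "finite V" "0 \<le> x"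
  shows "0 < ipoly V x"
proof -
  have "{} \<in> {S. S \<subseteq> V \<and> stable S}" by (simp add: stable_def)
  then have "x ^ card ({} :: 'a set) \<le> ipoly V x"
    unfolding ipoly_def using assms by (intro member_le_sum) auto
  then show ?thesis by simp
qed

text \<open>It suffices to delete one vertex \<open>v\<close> from \<open>A\<close>. At the first
  point \<open>q\<close> where positivity of \<open>ipoly V (- q)\<close> fails, both terms of
  \<open>ipoly V (- q) - q * ipoly (V - nbhd v) (- q)\<close> push the value down, so
  \<open>ipoly A (- q) \<le> 0\<close>.\<close>

lemma ipoly_pos_subset:
  assumes "finite V" "U \<subseteq> V" "\<And>s. 0 \<le> s \<Longrightarrow> s \<le> t \<Longrightarrow> 0 < ipoly V (- s)" "0 \<le> s" "s \<le> t"
  shows "0 < ipoly U (- s)"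
  using assms
proof (induction V arbitrary: U s t rule: finite_psubset_induct)
  case (psubset A)
  note pos = psubset.prems(2)
  show ?case
  proof (cases "U = A")
    case True
    then show ?thesis using psubset.prems by simp
  next
    case False
    then obtain v where v: "v \<in> A" "v \<notin> U" using psubset.prems by auto
    define V where "V = A - {v}"
    have A: "A = insert v V" "v \<notin> V" "finite V" "V \<subset> A"
      using v psubset.hyps by (auto simp: V_def)
    have V_pos: "0 < ipoly V (- r)" if "0 \<le> r" "r \<le> t" for r
    proof (rule ccontr)
      assume neg: "\<not> 0 < ipoly V (- r)"
      define Z where "Z = {0..t} \<inter> {q. ipoly V (- q) \<le> 0}"
      have cont: "continuous_on X (\<lambda>q. ipoly W (- q))" for X W
        unfolding ipoly_def by (intro continuous_intros)
      have "r \<in> Z" using that neg by (simp add: Z_def)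
      have "compact Z"
        unfolding Z_def by (auto intro!: compact_Int_closed closed_Collect_le cont)
      then obtain q where "q \<in> Z" and least: "\<And>p. p \<in> Z \<Longrightarrow> q \<le> p"
        using \<open>r \<in> Z\<close> compact_attains_inf[of Z] by blast
      then have q: "0 \<le> q" "q \<le> t" "ipoly V (- q) \<le> 0" by (auto simp: Z_def)
      have below: "0 < ipoly V (- p)" if "0 \<le> p" "p < q" for p
      proof (rule ccontr)
        assume "\<not> ?thesis"
        with that q have "p \<in> Z" by (auto simp: Z_def)
        with least[of p] that show False by simp
      qed
      have "0 < q"
        using q ipoly_0[OF A(3)] by (cases "q = 0") auto
      have nonneg: "0 \<le> ipoly (V - nbhd v) (- p)" if "0 \<le> p" "p < q" for p
        by (rule less_imp_le, rule psubset.IH[OF A(4), of _ p]) (use that below in auto)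
      \<comment> \<open>The induction hypothesis needs positivity for \<open>V\<close> on a whole
        interval, hence applies only strictly below \<open>q\<close>; the value at \<open>q\<close>
        is a limit from the left.\<close>
      have "0 \<le> ipoly (V - nbhd v) (- q)"
      proof (rule tendsto_lowerbound)
        show "((\<lambda>p. ipoly (V - nbhd v) (- p)) \<longlongrightarrow> ipoly (V - nbhd v) (- q)) (at_left q)"
          using cont[of UNIV "V - nbhd v"]
          by (simp add: continuous_on_eq_continuous_at continuous_at filterlim_at_split)
        show "\<forall>\<^sub>F p in at_left q. 0 \<le> ipoly (V - nbhd v) (- p)"
          using nonneg \<open>0 < q\<close>
            by (auto simp: eventually_at_left intro!: exI[of _ 0])
      qed simp
      then have "0 \<le> q * ipoly (V - nbhd v) (- q)" using q by simp
      moreover have "0 < ipoly A (- q)" using q pos by simp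
      ultimately show False using q A(1-3) ipoly_insert[of V v "- q"] by simp
    qed
    show ?thesis
      using psubset.IH[OF A(4), of U t s] psubset.prems v A V_pos by auto
  qed
qed

text \<open>This makes the \<open>Max\<close> in \<open>lambda1\<close> range over a nonempty
  set.\<close>

lemma ipoly_root_exists:
  assumes "finite V" "V \<noteq> {}"
  shows "\<exists>x. ipoly V x = 0"
proof (rule ccontr)
  assume no_root: "\<nexists>x. ipoly V x = 0"
  have cont: "continuous_on A (\<lambda>s. ipoly V (- s))" for A
    unfolding ipoly_def by (intro continuous_intros)
  have pos: "0 < ipoly V (- s)" if "0 \<le> s" for s
  proof (rule ccontr)
    assume "\<not> 0 < ipoly V (- s)"
    with that IVT2'[of "\<lambda>s. ipoly V (- s)" s 0 0] assms cont no_root ipoly_0 show False by auto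
  qed
  obtain v where "v \<in> V" using assms by auto
  then have "0 < ipoly {v} (- 1)"
    using ipoly_pos_subset[of V "{v}" 1 1] assms pos by auto
  then show False
    using ipoly_insert[of "{}" v "- 1"] by simp
qed

text \<open>
  A set \<open>U\<close> without edges to \<open>V - U\<close> is a union of components, so this says that every component
  contains a nonempty simplicial clique.
\<close>

definition covered :: "'a set \<Rightarrow> bool" where
  "covered V \<longleftrightarrow> (\<forall>U\<subseteq>V. U \<noteq> {} \<longrightarrow> (\<forall>u\<in>U. nbhd u \<inter> V \<subseteq> U)
      \<longrightarrow> (\<exists>K\<subseteq>U. K \<noteq> {} \<and> simplicial_in V K))"

end

section \<open>Simplicial cliques in claw-free graphs and the ratio bound\<close>

locale claw_free_adjacency = adjacency +
  assumes claw_free: "\<lbrakk>adj c p; adj c q; adj c r; p \<noteq> q; p \<noteq> r; q \<noteq> r\<rbrakk>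
    \<Longrightarrow> adj p q \<or> adj p r \<or> adj q r"
begin

text \<open>Two nonadjacent neighbours of \<open>u\<close> outside \<open>K\<close> and outside
  \<open>nbhd v\<close> would form a claw at \<open>u\<close> together with
  \<open>v\<close>.\<close>

lemma simplicial_in_nbhd_Diff:
  assumes "simplicial_in V K" "v \<in> K"
  shows "simplicial_in (V - K) (nbhd v \<inter> V - K)"
  unfolding simplicial_in_def
proof (intro conjI ballI)
  show "complete (nbhd v \<inter> V - K)" using assms by (simp add: simplicial_in_def)
  fix u assume u: "u \<in> nbhd v \<inter> V - K"
  show "complete (nbhd u \<inter> (V - K) - (nbhd v \<inter> V - K))"
    unfolding complete_def
  proof (intro ballI impI)
    fix p q
    assume "p \<in> nbhd u \<inter> (V - K) - (nbhd v \<inter> V - K)"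
      "q \<in> nbhd u \<inter> (V - K) - (nbhd v \<inter> V - K)" "p \<noteq> q"
    then show "adj p q"
      using claw_free[of u v p q] u assms adj_commute by auto
  qed
qed auto

text \<open>If some \<open>v\<close> in \<open>K\<close> has a neighbour in \<open>U\<close>, then
  \<open>nbhd v \<inter> V - K\<close> is a clique meeting \<open>U\<close>, so it lies in
  \<open>U\<close> and serves. Otherwise \<open>U\<close> has no edges to the rest of
  \<open>V\<close> either, and a simplicial clique of \<open>V\<close> inside \<open>U\<close>
  survives the deletion.\<close>

lemma covered_Diff:
  assumes "covered V" "simplicial_in V K"
  shows "covered (V - K)"
  unfolding covered_def
proof (intro allI impI)
  fix U assume U: "U \<subseteq> V - K" "U \<noteq> {}" "\<forall>u\<in>U. nbhd u \<inter> (V - K) \<subseteq> U"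
  show "\<exists>L\<subseteq>U. L \<noteq> {} \<and> simplicial_in (V - K) L"
  proof (cases "\<exists>u\<in>U. \<exists>v\<in>K. adj v u")
    case True
    then obtain u v where uv: "u \<in> U" "v \<in> K" "adj v u" by auto
    let ?L = "nbhd v \<inter> V - K"
    have "u \<in> ?L" using uv U by auto
    moreover have "complete ?L" using assms uv by (simp add: simplicial_in_def)
    ultimately have "?L \<subseteq> insert u (nbhd u \<inter> (V - K))"
      by (auto simp: complete_def)
    then have "?L \<subseteq> U" using U uv by auto
    then show ?thesis
      using simplicial_in_nbhd_Diff[OF assms(2) uv(2)] \<open>u \<in> ?L\<close> by blast
  next
    case False
    then have "\<forall>u\<in>U. nbhd u \<inter> V \<subseteq> U" using U adj_commute by blast
    with U assms(1) obtain L where L: "L \<subseteq> U" "L \<noteq> {}" "simplicial_in V L"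
      unfolding covered_def by (metis Diff_subset subset_trans)
    have "complete (nbhd u \<inter> (V - K) - L)" if "u \<in> L" for u
      using L(3) that by (auto simp: simplicial_in_def complete_def)
    then have "simplicial_in (V - K) L"
      using L U by (auto simp: simplicial_in_def)
    with L show ?thesis by blast
  qed
qed

text \<open>Both claims are proved in one induction. The ratio bound is restricted to cliques of
  size at most \<open>w\<close>, the only ones met after the first deletion; a clique of size
  \<open>w + 1\<close> need only give positivity.\<close>

lemma ipoly_pos_and_ratio:
  fixes t :: real
  assumes "finite V" "covered V" "\<And>K. K \<subseteq> V \<Longrightarrow> complete K \<Longrightarrow> card K \<le> Suc w"
    and t: "0 \<le> t" "4 * t * w < 1" and w: "1 \<le> w"
  shows "0 < ipoly V (- t) \<and>
    (\<forall>K. simplicial_in V K \<and> card K \<le> w \<longrightarrow> ipoly (V - K) (- t) \<le> 2 * ipoly V (- t))"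
  using assms(1-3)
proof (induction V rule: finite_psubset_induct)
  case (psubset V)
  note clique_le = psubset.prems(2)
  have step: "0 < ipoly (V - K) (- t) \<and>
      ipoly (V - K) (- t) * (1 - 2 * t * card K) \<le> ipoly V (- t)"
    if K: "simplicial_in V K" "K \<noteq> {}" for K
  proof -
    let ?W = "V - K"
    have KV: "K \<subseteq> V" "complete K" using K by (auto simp: simplicial_in_def)
    then have "?W \<subset> V" using K by auto
    moreover have "covered ?W" using covered_Diff psubset.prems(1) K by blast
    moreover have "card L \<le> Suc w" if "L \<subseteq> ?W" "complete L" for L
      using that clique_le by blast
    ultimately have IH: "0 < ipoly ?W (- t)"
      "\<And>L. simplicial_in ?W L \<Longrightarrow> card L \<le> w \<Longrightarrow> ipoly (?W - L) (- t) \<le> 2 * ipoly ?W (- t)"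
      using psubset.IH[of ?W] by auto
    have "ipoly (?W - nbhd v) (- t) \<le> 2 * ipoly ?W (- t)" if "v \<in> K" for v
    proof -
      let ?L = "nbhd v \<inter> V - K"
      \<comment> \<open>Adjoining \<open>v\<close> gives a clique of \<open>V\<close>, which lowers
        the size bound for \<open>?L\<close> from \<open>Suc w\<close> to \<open>w\<close>.\<close>
      have "complete (insert v ?L)"
        using K that adj_commute by (auto simp: simplicial_in_def complete_def)
      then have "card (insert v ?L) \<le> Suc w" using KV that by (intro clique_le) auto
      moreover have "finite ?L" using psubset.hyps by auto
      ultimately have "card ?L \<le> w" using that by simp
      moreover have "?W - ?L = ?W - nbhd v" by auto
      ultimately show ?thesis
        using IH(2)[OF simplicial_in_nbhd_Diff[OF K(1) that]] by simp
    qed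
    then have "(\<Sum>v\<in>K. ipoly (?W - nbhd v) (- t)) \<le> card K * (2 * ipoly ?W (- t))"
      by (rule sum_bounded_above)
    then have "t * (\<Sum>v\<in>K. ipoly (?W - nbhd v) (- t)) \<le> t * (card K * (2 * ipoly ?W (- t)))"
      using t(1) by (rule mult_left_mono)
    then show ?thesis
      using IH(1) ipoly_Diff_complete[OF psubset.hyps KV(2,1), of "- t"]
      by (simp add: algebra_simps)
  qed
  have pos: "0 < ipoly V (- t)"
  proof (cases "V = {}")
    case False
    then obtain K where K: "simplicial_in V K" "K \<noteq> {}"
      using psubset.prems(1) by (auto simp: covered_def)
    then have "card K \<le> Suc w" using clique_le by (auto simp: simplicial_in_def)
    \<comment> \<open>With \<open>1 \<le> w\<close>, this crude bound turns the factor
      \<open>1 - 2 * t * card K\<close> into at least \<open>1 - 4 * t * w\<close>, which is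
      positive.\<close>
    then have "card K \<le> 2 * w" using w by simp
    then have "t * card K \<le> t * (2 * w)"
      using t by (intro mult_left_mono) linarith+
    then have "0 < 1 - 2 * t * card K" using t by simp
    with step[OF K] show ?thesis
      by (meson mult_pos_pos less_le_trans)
  qed simp
  have "ipoly (V - K) (- t) \<le> 2 * ipoly V (- t)" if K: "simplicial_in V K" "card K \<le> w" for K
  proof (cases "K = {}")
    case False
    have "t * card K \<le> t * w" using t K by (intro mult_left_mono) auto
    then have "1 / 2 \<le> 1 - 2 * t * card K" using t by simp
    then have "ipoly (V - K) (- t) * (1 / 2) \<le> ipoly (V - K) (- t) * (1 - 2 * t * card K)"
      using step[OF K(1) False] by (intro mult_left_mono) auto
    then show ?thesis using step[OF K(1) False] by linarith
  qed (use pos in simp)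
  with pos show ?case by blast
qed

end

section \<open>Transfer from digraphs to adjacency relations\<close>

lemma arcs_ends_induce: "arcs_ends (G \<restriction> S) = arcs_ends G \<inter> S \<times> S"
  by (auto simp: arcs_ends_def arc_to_ends_def)

lemma (in graph) graph_induce:
  assumes "S \<subseteq> verts G"
  shows "graph (G \<restriction> S)"
proof -
  have "induced_subgraph (G \<restriction> S) G" using assms by (rule induced_induce)
  then have "digraph (G \<restriction> S)" "sym_digraph (G \<restriction> S)"
    by (rule digraphI_induced, rule induced_graph_imp_graph)
  then show ?thesis
    by (intro graph.intro pseudo_graph.intro digraph.axioms(1))
qed

lemma (in graph) adjacency_dominates: "adjacency (\<lambda>u v. u \<rightarrow>\<^bsub>G\<^esub> v)"
  by unfold_locales (use arcs_ends_symmetric[OF sym_arcs] adj_not_same in blast)+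

lemma (in graph) claw_free_adjacency_dominates:
  assumes "claw_free G"
  shows "claw_free_adjacency (\<lambda>u v. u \<rightarrow>\<^bsub>G\<^esub> v)"
proof -
  interpret adjacency "\<lambda>u v. u \<rightarrow>\<^bsub>G\<^esub> v" by (rule adjacency_dominates)
  show ?thesis
  proof
    fix c p q r
    assume adj: "c \<rightarrow>\<^bsub>G\<^esub> p" "c \<rightarrow>\<^bsub>G\<^esub> q" "c \<rightarrow>\<^bsub>G\<^esub> r" and ne: "p \<noteq> q" "p \<noteq> r" "q \<noteq> r"
    show "p \<rightarrow>\<^bsub>G\<^esub> q \<or> p \<rightarrow>\<^bsub>G\<^esub> r \<or> q \<rightarrow>\<^bsub>G\<^esub> r"
    proof (rule ccontr)
      assume none: "\<not> (p \<rightarrow>\<^bsub>G\<^esub> q \<or> p \<rightarrow>\<^bsub>G\<^esub> r \<or> q \<rightarrow>\<^bsub>G\<^esub> r)"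
      let ?S = "{c} \<union> {p, q, r}"
      have S: "?S \<subseteq> verts G" using adj by (auto dest: adj_in_verts)
      have rev: "\<not> (q \<rightarrow>\<^bsub>G\<^esub> p \<or> r \<rightarrow>\<^bsub>G\<^esub> p \<or> r \<rightarrow>\<^bsub>G\<^esub> q)"
        using none adj_sym by blast
      have cne: "c \<notin> {p, q, r}" using adj adj_irrefl by auto
      \<comment> \<open>Without edges among \<open>p\<close>, \<open>q\<close>, \<open>r\<close>,
        the induced subgraph has exactly the arcs of a star centred at \<open>c\<close>.\<close>
      have ends: "arcs_ends (G \<restriction> ?S) = {c} \<times> {p, q, r} \<union> {p, q, r} \<times> {c}"
        unfolding arcs_ends_induce set_eq_iff split_paired_all
        using adj adj[THEN adj_sym] none rev adj_irrefl by blast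
      have "K\<^bsub>1,3\<^esub> (G \<restriction> ?S)"
        unfolding complete_bipartite_digraph_def ends
        using graph_induce[OF S] cne ne
        by (intro conjI exI[of _ "{c}"] exI[of _ "{p, q, r}"]) simp_all
      moreover have "induced_subgraph (G \<restriction> ?S) G" using S by (rule induced_induce)
      ultimately show False using assms unfolding claw_free_def by blast
    qed
  qed
qed

section \<open>The bound on the largest root\<close>

theorem corollary4p9:
  fixes G :: "('a, 'b) pre_digraph"
  assumes "graph G"
    and "simplicial_graph G"
    and "\<forall>C\<in>components G. simplicial_graph C"
  shows "lambda1 G \<le> - 1 / (4 * (real (clique_number G) - 1))"
proof -
  interpret graph G by fact
  interpret claw_free_adjacency "\<lambda>u v. u \<rightarrow>\<^bsub>G\<^esub> v"
    using assms by (auto simp: simplicial_graph_def intro: claw_free_adjacency_dominates)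
  have clique_iff: "clique G K \<longleftrightarrow> K \<subseteq> verts G \<and> complete K" for K
    by (simp add: clique_def complete_def)
  have poly: "poly (indep_poly G) x = ipoly (verts G) x" for x
    by (simp add: indep_poly_def ipoly_def independent_set_def stable_def poly_sum poly_monom)
  have cov: "covered (verts G)"
    unfolding covered_def
  proof (intro allI impI)
    fix U assume U: "U \<subseteq> verts G" "U \<noteq> {}" "\<forall>u\<in>U. nbhd u \<inter> verts G \<subseteq> U"
    then obtain u where u: "u \<in> U" by auto
    \<comment> \<open>The component of \<open>u\<close> stays inside \<open>U\<close>, because no
      edge leaves \<open>U\<close>.\<close>
    let ?C = "G \<restriction> {v. u \<rightarrow>\<^sup>*\<^bsub>G\<^esub> v}"
    have "?C \<in> sccs" using u U by (intro induce_reachable_is_in_sccs) auto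
    then obtain K where K: "simplicial_clique ?C K"
      using assms(3) by (auto simp: simplicial_graph_def)
    have reach: "v \<in> U" if "u \<rightarrow>\<^sup>*\<^bsub>G\<^esub> v" for v
      using that by (induction rule: reachable_induct) (use u U adj_in_verts in blast)+
    have KC: "K \<subseteq> {v. u \<rightarrow>\<^sup>*\<^bsub>G\<^esub> v}" using K by (auto simp: simplicial_clique_def clique_def)
    have "complete K" using K
      by (auto simp: simplicial_clique_def clique_def complete_def arcs_ends_induce)
    moreover have "complete (nbhd v \<inter> verts G - K)" if "v \<in> K" for v
    proof -
      \<comment> \<open>A component contains all neighbours of its vertices, so a simplicial clique
        of \<open>?C\<close> is one of the whole graph.\<close>
      have "neighbors ?C v = nbhd v"
        using KC that by (auto simp: neighbors_def arcs_ends_induce intro: reachable_adj_trans)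
      then have "clique ?C (nbhd v - K)"
        using K that unfolding simplicial_clique_def by metis
      then show ?thesis
        unfolding clique_def complete_def arcs_ends_induce by blast
    qed
    ultimately have "simplicial_in (verts G) K"
      using KC reach U unfolding simplicial_in_def by blast
    moreover have "K \<subseteq> U" using KC reach by auto
    moreover have "K \<noteq> {}" using K by (simp add: simplicial_clique_def)
    ultimately show "\<exists>K\<subseteq>U. K \<noteq> {} \<and> simplicial_in (verts G) K" by blast
  qed
  have fin: "finite {K. clique G K}"
    by (rule finite_subset[of _ "Pow (verts G)"]) (auto simp: clique_def)
  have card_le: "card K \<le> clique_number G" if "K \<subseteq> verts G" "complete K" for K
    unfolding clique_number_def using that by (intro Max_ge finite_imageI[OF fin] imageI) (simp add: clique_iff)
  have "verts G \<noteq> {}"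
    using assms(2) by (auto simp: simplicial_graph_def simplicial_clique_def clique_def)
  then obtain v where "v \<in> verts G" by auto
  then have "1 \<le> clique_number G" using card_le[of "{v}"] by (simp add: complete_def)
  have "indep_poly G \<noteq> 0" using poly[of 0] ipoly_0[of "verts G"] by auto
  then have "finite {x. poly (indep_poly G) x = 0}" by (rule poly_roots_finite)
  moreover have "{x. poly (indep_poly G) x = 0} \<noteq> {}"
    using ipoly_root_exists[of "verts G"] \<open>verts G \<noteq> {}\<close> by (simp add: poly)
  moreover have "x \<le> - 1 / (4 * (real (clique_number G) - 1))"
    if "x \<in> {x. poly (indep_poly G) x = 0}" for x
  proof (rule ccontr)
    assume above: "\<not> ?thesis"
    have root: "ipoly (verts G) x = 0" using that by (simp add: poly)
    then have "x < 0" using ipoly_pos_of_nonneg[of "verts G" x] by fastforce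
    show False
    proof (cases "clique_number G = 1")
      case True
      \<comment> \<open>here the bound is the junk value \<open>- 1 / 0 = 0\<close>\<close>
      with above \<open>x < 0\<close> show False by simp
    next
      case False
      define w where "w = clique_number G - 1"
      have w: "1 \<le> w" "clique_number G = Suc w"
        using False \<open>1 \<le> clique_number G\<close> by (auto simp: w_def)
      \<comment> \<open>A root above the bound gives an admissible \<open>t = - x\<close>, at which
        the polynomial would be positive.\<close>
      then have "4 * (- x) * w < 1" using above by (simp add: field_simps)
      with ipoly_pos_and_ratio[of "verts G" w "- x"] cov card_le w \<open>x < 0\<close> root
      show False by auto
    qed
  qed
  ultimately show ?thesis
    unfolding lambda1_def by (intro Max.boundedI)
qed

end
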